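(* Let $Y$ be a closed sublattice of a Banach lattice $X$, and let $(x_k)$ be a sequence in $Y$. Then $(x_k)$ is bibasic in $Y$ if and only if it is bibasic in $X$.
   Context: A sequence $(x_k)$ in a Banach lattice $X$ is called bibasic (in $X$) if it is a Schauder basic sequence (i.e. a Schauder basis of its closed linear span) which satisfies any, and hence all, of the following conditions (known to be equivalent for basic sequences): whenever $\sum_{k=1}^\infty\alpha_kx_k$ converges in norm to $x$, the partial sums converge to $x$ (a) uniformly in $X$, or (b) in $\sigma$-order in $X$, or (c) in order in $X$, or (d) the partial sums are order bounded in $X$, or (e) the sequence $\bigl(\bigvee_{n=1}^m|\sum_{k=1}^n\alpha_kx_k|\bigr)_m$ is norm bounded; or (f) there is $M\ge1$ with $\bigl\|\bigvee_{n=1}^m|\sum_{k=1}^n\alpha_kx_k|\bigr\|\le M\bigl\|\sum_{k=1}^m\alpha_kx_k\bigr\|$ for all $m$ and all scalars $\alpha_1,\dots,\alpha_m$. Here $z_n\to z$ uniformly means: there is $e\in X_+$ such that for every $\varepsilon>0$, $|z_n-z|\le\varepsilon e$ for all large $n$; $z_n\to z$ in order means: there is a net $u_\gamma\downarrow0$ such that for each $\gamma$, $|z_n-z|\le u_\gamma$ for all large $n$; $z_n\to z$ in $\sigma$-order means: there is a sequence $u_n\downarrow 0$ with $|z_n-z|\le u_n$ for all $n$. *)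

theory Defs
  imports "HOL-Analysis.Analysis" "HOL-Library.Lattice_Algebras" "HOL-Library.Lub_Glb"
begin

class banach_lattice = banach + ordered_real_vector + lattice_ab_group_add_abs +
  assumes norm_mono_abs: "\<bar>x\<bar> \<le> \<bar>y\<bar> \<Longrightarrow> norm x \<le> norm y"

instance real :: banach_lattice
  by standard simp

definition closed_sublattice :: "'a::banach_lattice set \<Rightarrow> bool" where
  "closed_sublattice Y \<longleftrightarrow>
     closed Y \<and> subspace Y \<and> (\<forall>x\<in>Y. \<forall>y\<in>Y. sup x y \<in> Y \<and> inf x y \<in> Y)"

text \<open>
  A closed sublattice \<open>Y\<close> is a Banach lattice in its own right. Notions that depend on the
  surrounding lattice (order bounds, decreasing to zero, the modes of convergence) take the
  carrier \<open>A\<close> of that lattice as an argument: \<open>A = UNIV\<close> gives the notion in the whole space,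
  \<open>A = Y\<close> the notion in \<open>Y\<close>.
\<close>

subsection \<open>Convergence in a Banach lattice\<close>

definition uniformly_convergent_in ::
    "'a::banach_lattice set \<Rightarrow> (nat \<Rightarrow> 'a) \<Rightarrow> 'a \<Rightarrow> bool" where
  "uniformly_convergent_in A z l \<longleftrightarrow>
     (\<exists>e\<in>A. 0 \<le> e \<and> (\<forall>\<epsilon>>0. \<forall>\<^sub>F n in sequentially. \<bar>z n - l\<bar> \<le> \<epsilon> *\<^sub>R e))"

definition sigma_order_convergent_in ::
    "'a::banach_lattice set \<Rightarrow> (nat \<Rightarrow> 'a) \<Rightarrow> 'a \<Rightarrow> bool" where
  "sigma_order_convergent_in A z l \<longleftrightarrow>
     (\<exists>u. range u \<subseteq> A \<and> decseq u \<and> isGlb A (range u) 0 \<and> (\<forall>n. \<bar>z n - l\<bar> \<le> u n))"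

definition directed_preorder :: "'i set \<Rightarrow> ('i \<Rightarrow> 'i \<Rightarrow> bool) \<Rightarrow> bool" where
  "directed_preorder I r \<longleftrightarrow>
     I \<noteq> {} \<and> (\<forall>i\<in>I. r i i) \<and>
     (\<forall>i\<in>I. \<forall>j\<in>I. \<forall>k\<in>I. r i j \<longrightarrow> r j k \<longrightarrow> r i k) \<and>
     (\<forall>i\<in>I. \<forall>j\<in>I. \<exists>k\<in>I. r i k \<and> r j k)"

definition net_decreases_to_zero_in ::
    "'a::banach_lattice set \<Rightarrow> 'i set \<Rightarrow> ('i \<Rightarrow> 'i \<Rightarrow> bool) \<Rightarrow> ('i \<Rightarrow> 'a) \<Rightarrow> bool" where
  "net_decreases_to_zero_in A I r u \<longleftrightarrow>
     directed_preorder I r \<and> u ` I \<subseteq> A \<and>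
     (\<forall>i\<in>I. \<forall>j\<in>I. r i j \<longrightarrow> u j \<le> u i) \<and> isGlb A (u ` I) 0"

text \<open>
  HOL cannot quantify existentially over the index type of a net, so index sets are taken
  inside \<open>'a\<close>. The lemma \<open>order_convergent_inI\<close> below shows that nets indexed by any other type
  give the same notion, since a decreasing net can be reindexed by its range.
\<close>

definition order_convergent_in ::
    "'a::banach_lattice set \<Rightarrow> (nat \<Rightarrow> 'a) \<Rightarrow> 'a \<Rightarrow> bool" where
  "order_convergent_in A z l \<longleftrightarrow>
     (\<exists>(I :: 'a set) r u. net_decreases_to_zero_in A I r u \<and>
        (\<forall>i\<in>I. \<forall>\<^sub>F n in sequentially. \<bar>z n - l\<bar> \<le> u i))"

lemma order_convergent_inI:
  fixes I :: "'i set" and u :: "'i \<Rightarrow> 'a::banach_lattice"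
  assumes net: "net_decreases_to_zero_in A I r u"
    and dom: "\<forall>i\<in>I. \<forall>\<^sub>F n in sequentially. \<bar>z n - l\<bar> \<le> u i"
  shows "order_convergent_in A z l"
proof -
  have nonempty: "I \<noteq> {}" and dir: "\<forall>i\<in>I. \<forall>j\<in>I. \<exists>k\<in>I. r i k \<and> r j k"
    and dec: "\<forall>i\<in>I. \<forall>j\<in>I. r i j \<longrightarrow> u j \<le> u i"
    and inA: "u ` I \<subseteq> A" and glb: "isGlb A (u ` I) 0"
    using net unfolding net_decreases_to_zero_in_def directed_preorder_def
    by blast+
  let ?r = "\<lambda>a b :: 'a. b \<le> a"
  have directed: "\<exists>c\<in>u ` I. ?r a c \<and> ?r b c" if ab: "a \<in> u ` I" "b \<in> u ` I" for a b
  proof -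
    from ab(1) obtain i where i: "i \<in> I" "a = u i" by (rule imageE)
    from ab(2) obtain j where j: "j \<in> I" "b = u j" by (rule imageE)
    from dir i j obtain k where k: "k \<in> I" "r i k" "r j k" by blast
    have "u k \<le> a" "u k \<le> b" using dec i j k by simp_all
    moreover have "u k \<in> u ` I" using k(1) by (rule imageI)
    ultimately show ?thesis by (intro bexI[of _ "u k"] conjI)
  qed
  have "directed_preorder (u ` I) ?r"
    unfolding directed_preorder_def
  proof (intro conjI ballI impI)
    show "u ` I \<noteq> {}" using nonempty by simp
    show "?r a c" if "?r a b" "?r b c" for a b c
      using that(2) that(1) by (rule order_trans)
  qed (simp_all only: order_refl directed)
  then have "net_decreases_to_zero_in A (u ` I) ?r (\<lambda>a. a)"
    unfolding net_decreases_to_zero_in_def using inA glb by (simp only: image_ident) simp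
  moreover have "\<forall>a\<in>u ` I. \<forall>\<^sub>F n in sequentially. \<bar>z n - l\<bar> \<le> a"
    using dom by (simp only: ball_simps)
  ultimately show ?thesis
    unfolding order_convergent_in_def
    by (intro exI[of _ "u ` I"] exI[of _ ?r] exI[of _ "\<lambda>a. a"] conjI)
qed

definition order_bounded_in :: "'a::banach_lattice set \<Rightarrow> (nat \<Rightarrow> 'a) \<Rightarrow> bool" where
  "order_bounded_in A z \<longleftrightarrow> (\<exists>a\<in>A. \<exists>b\<in>A. \<forall>n. a \<le> z n \<and> z n \<le> b)"

subsection \<open>Basic and bibasic sequences\<close>

text \<open>Sequences are indexed from \<open>0\<close>, so \<open>partial_sum \<alpha> x m\<close> has \<open>m + 1\<close> terms.\<close>

definition partial_sum :: "(nat \<Rightarrow> real) \<Rightarrow> (nat \<Rightarrow> 'a::real_vector) \<Rightarrow> nat \<Rightarrow> 'a" where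
  "partial_sum \<alpha> x m = (\<Sum>k\<le>m. \<alpha> k *\<^sub>R x k)"

definition schauder_basic :: "(nat \<Rightarrow> 'a::banach) \<Rightarrow> bool" where
  "schauder_basic x \<longleftrightarrow>
     (\<forall>y \<in> closure (span (range x)). \<exists>!\<alpha>. partial_sum \<alpha> x \<longlonglongrightarrow> y)"

text \<open>
  \<open>Sup_fin\<close> is formed in the whole space, but a sublattice is closed under finite suprema,
  so this is also the supremum in the sublattice.
\<close>

definition maximal_partial_sum ::
    "(nat \<Rightarrow> real) \<Rightarrow> (nat \<Rightarrow> 'a::banach_lattice) \<Rightarrow> nat \<Rightarrow> 'a" where
  "maximal_partial_sum \<alpha> x m = Sup_fin ((\<lambda>n. \<bar>partial_sum \<alpha> x n\<bar>) ` {..m})"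

text \<open>
  Six properties are in use, interchangeably, as the defining property of a bibasic sequence;
  for basic sequences they are known to be equivalent. The parameter of \<open>bibasic_in\<close> records which
  of them is taken as the definition, so that results can be stated for every choice.
\<close>

datatype bibasic_criterion =
    Uniform_Convergence
  | Sigma_Order_Convergence
  | Order_Convergence
  | Order_Boundedness
  | Maximal_Norm_Boundedness
  | Maximal_Inequality

fun satisfies_criterion ::
    "bibasic_criterion \<Rightarrow> 'a::banach_lattice set \<Rightarrow> (nat \<Rightarrow> 'a) \<Rightarrow> bool" where
  "satisfies_criterion Uniform_Convergence A x \<longleftrightarrow>
     (\<forall>\<alpha> y. partial_sum \<alpha> x \<longlonglongrightarrow> y \<longrightarrow> uniformly_convergent_in A (partial_sum \<alpha> x) y)"
| "satisfies_criterion Sigma_Order_Convergence A x \<longleftrightarrow>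
     (\<forall>\<alpha> y. partial_sum \<alpha> x \<longlonglongrightarrow> y \<longrightarrow> sigma_order_convergent_in A (partial_sum \<alpha> x) y)"
| "satisfies_criterion Order_Convergence A x \<longleftrightarrow>
     (\<forall>\<alpha> y. partial_sum \<alpha> x \<longlonglongrightarrow> y \<longrightarrow> order_convergent_in A (partial_sum \<alpha> x) y)"
| "satisfies_criterion Order_Boundedness A x \<longleftrightarrow>
     (\<forall>\<alpha> y. partial_sum \<alpha> x \<longlonglongrightarrow> y \<longrightarrow> order_bounded_in A (partial_sum \<alpha> x))"
| "satisfies_criterion Maximal_Norm_Boundedness A x \<longleftrightarrow>
     (\<forall>\<alpha> y. partial_sum \<alpha> x \<longlonglongrightarrow> y \<longrightarrow> bounded (range (maximal_partial_sum \<alpha> x)))"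
| "satisfies_criterion Maximal_Inequality A x \<longleftrightarrow>
     (\<exists>M\<ge>1. \<forall>m \<alpha>. norm (maximal_partial_sum \<alpha> x m) \<le> M * norm (partial_sum \<alpha> x m))"

definition bibasic_in ::
    "bibasic_criterion \<Rightarrow> 'a::banach_lattice set \<Rightarrow> (nat \<Rightarrow> 'a) \<Rightarrow> bool" where
  "bibasic_in c A x \<longleftrightarrow> schauder_basic x \<and> satisfies_criterion c A x"

end

theory Submission
  imports Defs
begin

text \<open>The maximal inequality mentions only norms and finite suprema, so it reads the same in \<open>Y\<close> and
  in the whole space. It therefore suffices that in every closed sublattice the six criteria are
  equivalent. From norm boundedness of the maximal partial sums to the maximal inequality one applies
  Zabreiko's lemma to the supremum of their norms, a countably subadditive functional on the closed
  span. From the maximal inequality back to uniform convergence, the regulator is a norm-convergent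
  series of finite suprema, so a closed sublattice that contains the sequence contains it too.\<close>

section \<open>Norm and order in a Banach lattice\<close>

lemma norm_le_of_abs_le:
  fixes x y :: "'a::banach_lattice"
  assumes "\<bar>x\<bar> \<le> y"
  shows "norm x \<le> norm y"
proof -
  have "0 \<le> y" using abs_ge_zero assms by (rule order_trans)
  with assms show ?thesis by (intro norm_mono_abs) simp
qed

text \<open>The reverse triangle inequality holds in the lattice order, and monotonicity of the norm
  turns it into a norm estimate.\<close>

lemma tendsto_abs_lattice:
  fixes l :: "'a::banach_lattice"
  assumes "(f \<longlongrightarrow> l) F"
  shows "((\<lambda>n. \<bar>f n\<bar>) \<longlongrightarrow> \<bar>l\<bar>) F"
proof -
  have "((\<lambda>n. \<bar>f n\<bar> - \<bar>l\<bar>) \<longlongrightarrow> 0) F"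
  proof (rule Lim_null_comparison)
    show "\<forall>\<^sub>F n in F. norm (\<bar>f n\<bar> - \<bar>l\<bar>) \<le> norm (f n - l)"
      by (intro always_eventually allI norm_mono_abs abs_triangle_ineq3)
    show "((\<lambda>n. norm (f n - l)) \<longlongrightarrow> 0) F"
      using assms by (simp add: tendsto_norm_zero LIM_zero)
  qed
  then show ?thesis by (rule LIM_zero_cancel)
qed

text \<open>Order and topology are tied together only through the norm. The positive cone is closed
  because its elements are the fixed points of the absolute value, which is norm continuous.\<close>

lemma tendsto_le_lattice:
  fixes l m :: "'a::banach_lattice"
  assumes F: "F \<noteq> bot" and f: "(f \<longlongrightarrow> l) F" and g: "(g \<longlongrightarrow> m) F"
    and le: "\<forall>\<^sub>F n in F. f n \<le> g n"
  shows "l \<le> m"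
proof -
  have *: "((\<lambda>n. g n - f n) \<longlongrightarrow> m - l) F"
    using g f by (rule tendsto_diff)
  from tendsto_abs_lattice[OF this] have "((\<lambda>n. g n - f n) \<longlongrightarrow> \<bar>m - l\<bar>) F"
    by (rule Lim_transform_eventually) (use le in eventually_elim, simp)
  with * have "\<bar>m - l\<bar> = m - l"
    using F tendsto_unique by blast
  then have "0 \<le> m - l"
    by (metis abs_ge_zero)
  then show ?thesis by simp
qed

text \<open>The finite triangle inequality passes to the limit because the order is closed. Both the
  countable subadditivity and the rate of uniform convergence below rest on this estimate.\<close>

lemma abs_sums_le:
  fixes z w :: "nat \<Rightarrow> 'a::banach_lattice"
  assumes "z sums s" "w sums t" "\<And>i. \<bar>z i\<bar> \<le> w i"
  shows "\<bar>s\<bar> \<le> t"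
proof (rule tendsto_le_lattice[OF sequentially_bot])
  show "(\<lambda>n. \<bar>sum z {..<n}\<bar>) \<longlonglongrightarrow> \<bar>s\<bar>"
    using assms(1) by (intro tendsto_abs_lattice) (simp add: sums_def)
  show "(\<lambda>n. sum w {..<n}) \<longlonglongrightarrow> t"
    using assms(2) by (simp add: sums_def)
  show "\<forall>\<^sub>F n in sequentially. \<bar>sum z {..<n}\<bar> \<le> sum w {..<n}"
    by (intro always_eventually allI order_trans[OF sum_abs] sum_mono assms(3))
qed

text \<open>The order axioms scale only by nonnegative factors, so for negative \<open>c\<close> the
  sign is moved to the vector; \<open>y\<close> and \<open>- y\<close> lie below the same absolute
  value.\<close>

lemma abs_scaleR_le:
  fixes x :: "'a::banach_lattice"
  shows "\<bar>c *\<^sub>R x\<bar> \<le> \<bar>c\<bar> *\<^sub>R \<bar>x\<bar>"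
proof -
  have "c *\<^sub>R y \<le> \<bar>c\<bar> *\<^sub>R \<bar>y\<bar>" for y :: 'a
  proof (cases "0 \<le> c")
    case True
    then show ?thesis by (simp add: scaleR_left_mono abs_ge_self)
  next
    case False
    then have "(- c) *\<^sub>R (- y) \<le> (- c) *\<^sub>R \<bar>y\<bar>"
      by (intro scaleR_left_mono) (simp_all add: abs_ge_minus_self)
    with False show ?thesis by simp
  qed
  from this[of x] this[of "- x"] show ?thesis
    by (intro abs_leI) simp_all
qed

section \<open>Closed sublattices and closed subspaces\<close>

lemma closed_sublattice_UNIV: "closed_sublattice UNIV"
  by (simp add: closed_sublattice_def)

lemma closed_sublattice_abs:
  assumes "closed_sublattice A" "x \<in> A"
  shows "\<bar>x\<bar> \<in> A"
  using assms by (simp add: closed_sublattice_def abs_lattice subspace_neg)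

lemma closed_sublattice_Sup_fin:
  assumes "closed_sublattice A" "finite S" "S \<noteq> {}" "S \<subseteq> A"
  shows "Sup_fin S \<in> A"
  using assms(2-) by (induction rule: finite_ne_induct)
    (use assms(1) in \<open>auto simp: closed_sublattice_def\<close>)

lemma subspace_closure:
  fixes S :: "'a::real_normed_vector set"
  assumes "subspace S"
  shows "subspace (closure S)"
proof (rule subspaceI)
  show "0 \<in> closure S"
    using assms subspace_0 closure_subset by blast
  show "a + b \<in> closure S" if ab: "a \<in> closure S" "b \<in> closure S" for a b
  proof -
    from ab obtain f g where "\<forall>n. f n \<in> S" "f \<longlonglongrightarrow> a" "\<forall>n. g n \<in> S" "g \<longlonglongrightarrow> b"
      unfolding closure_sequential by blast
    then show ?thesis unfolding closure_sequential
      by (intro exI[of _ "\<lambda>n. f n + g n"] conjI allI tendsto_add)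
        (simp_all add: assms subspace_add)
  qed
  show "c *\<^sub>R a \<in> closure S" if a: "a \<in> closure S" for a c
  proof -
    from a obtain f where "\<forall>n. f n \<in> S" "f \<longlonglongrightarrow> a"
      unfolding closure_sequential by blast
    then show ?thesis unfolding closure_sequential
      by (intro exI[of _ "\<lambda>n. c *\<^sub>R f n"] conjI allI tendsto_scaleR tendsto_const)
        (simp_all add: assms subspace_scale)
  qed
qed

lemma closed_subspace_sums:
  fixes w :: "nat \<Rightarrow> 'a::real_normed_vector"
  assumes "closed A" "subspace A" "\<And>i. w i \<in> A" "w sums t"
  shows "t \<in> A"
proof -
  have "sum w {..<n} \<in> A" for n
    using assms(2,3) by (simp add: subspace_sum)
  then show ?thesis
    using assms(1,4) unfolding sums_def by (metis closed_sequentially)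
qed

section \<open>Maximal partial sums\<close>

lemma partial_sum_le_maximal:
  "n \<le> m \<Longrightarrow> \<bar>partial_sum \<alpha> x n\<bar> \<le> maximal_partial_sum \<alpha> x m"
  unfolding maximal_partial_sum_def by (intro Sup_fin.coboundedI) auto

lemma maximal_partial_sum_le:
  "(\<And>n. n \<le> m \<Longrightarrow> \<bar>partial_sum \<alpha> x n\<bar> \<le> b) \<Longrightarrow> maximal_partial_sum \<alpha> x m \<le> b"
  unfolding maximal_partial_sum_def by (intro Sup_fin.boundedI) auto

lemma maximal_partial_sum_nonneg: "0 \<le> maximal_partial_sum \<alpha> x m"
  using partial_sum_le_maximal[of m m] abs_ge_zero order_trans by blast

lemma norm_maximal_partial_sum_le:
  assumes "\<And>n. n \<le> m \<Longrightarrow> \<bar>partial_sum \<alpha> x n\<bar> \<le> b"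
  shows "norm (maximal_partial_sum \<alpha> x m) \<le> norm b"
  by (intro norm_le_of_abs_le)
    (simp add: abs_of_nonneg[OF maximal_partial_sum_nonneg] maximal_partial_sum_le assms)

lemma norm_partial_sum_le_maximal:
  "n \<le> m \<Longrightarrow> norm (partial_sum \<alpha> x n) \<le> norm (maximal_partial_sum \<alpha> x m)"
  by (intro norm_le_of_abs_le partial_sum_le_maximal)

lemma partial_sum_mem:
  assumes "subspace A" "\<And>k. x k \<in> A"
  shows "partial_sum \<alpha> x n \<in> A"
  unfolding partial_sum_def using assms by (intro subspace_sum subspace_scale)

lemma maximal_partial_sum_mem:
  assumes "closed_sublattice A" "\<And>k. x k \<in> A"
  shows "maximal_partial_sum \<alpha> x m \<in> A"
  unfolding maximal_partial_sum_def
  using assms by (intro closed_sublattice_Sup_fin)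
    (auto simp: closed_sublattice_def intro!: closed_sublattice_abs partial_sum_mem)

lemma partial_sum_scale: "partial_sum (\<lambda>k. c * \<alpha> k) x n = c *\<^sub>R partial_sum \<alpha> x n"
  by (simp add: partial_sum_def scaleR_sum_right)

text \<open>Cut-off coefficients have eventually constant partial sums, which makes a finite sum the
  limit of its own expansion.\<close>

lemma partial_sum_truncate:
  "partial_sum (\<lambda>k. if k \<le> m then \<alpha> k else 0) x n = partial_sum \<alpha> x (min n m)"
proof -
  have "partial_sum (\<lambda>k. if k \<le> m then \<alpha> k else 0) x n
      = (\<Sum>k\<le>n. if k \<le> m then \<alpha> k *\<^sub>R x k else 0)"
    unfolding partial_sum_def by (intro sum.cong) auto
  also have "\<dots> = (\<Sum>k | k \<in> {..n} \<and> k \<le> m. \<alpha> k *\<^sub>R x k)"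
    by (simp only: sum.inter_filter finite_atMost)
  also have "{k. k \<in> {..n} \<and> k \<le> m} = {..min n m}" by auto
  finally show ?thesis by (simp add: partial_sum_def)
qed

text \<open>Turns the oscillation of the partial sums beyond \<open>m\<close> into partial sums of
  another coefficient sequence, to which the maximal inequality applies.\<close>

lemma partial_sum_block:
  "partial_sum (\<lambda>k. if k \<le> m then 0 else \<alpha> k) x n
     = partial_sum \<alpha> x (max n m) - partial_sum \<alpha> x m"
proof -
  have "partial_sum (\<lambda>k. if k \<le> m then 0 else \<alpha> k) x n
      = partial_sum \<alpha> x n - partial_sum (\<lambda>k. if k \<le> m then \<alpha> k else 0) x n"
    unfolding partial_sum_def sum_subtractf[symmetric] by (intro sum.cong) auto
  then show ?thesis
    by (cases "n \<le> m") (simp_all add: partial_sum_truncate max_def min_def)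
qed

section \<open>Countably subadditive functionals\<close>

text \<open>Zabreiko's lemma: Baire's theorem makes some sublevel set dense near a point, hence, by
  symmetry, dense near \<open>0\<close>; successive approximation then removes the closure.\<close>

theorem countably_subadditive_imp_bounded:
  fixes p :: "'a::banach \<Rightarrow> real" and S :: "'a set"
  assumes S: "closed S" "subspace S"
    and nonneg: "\<And>y. y \<in> S \<Longrightarrow> 0 \<le> p y"
    and homogeneous: "\<And>c y. y \<in> S \<Longrightarrow> p (c *\<^sub>R y) \<le> \<bar>c\<bar> * p y"
    and countably_subadditive: "\<And>v y. \<lbrakk>\<And>i. v i \<in> S; v sums y; summable (\<lambda>i. p (v i))\<rbrakk>
           \<Longrightarrow> p y \<le> (\<Sum>i. p (v i))"
  shows "\<exists>M. \<forall>y\<in>S. p y \<le> M * norm y"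
proof -
  have 0: "0 \<in> S" using S(2) by (rule subspace_0)
  have p0: "p 0 = 0"
    using homogeneous[OF 0, of 0] nonneg[OF 0] by simp
  have subadditive: "p (a + b) \<le> p a + p b" if "a \<in> S" "b \<in> S" for a b
  proof -
    \<comment> \<open>Finite subadditivity is the countable one for a sequence padded with zeros,
      which cost nothing since \<open>p 0 = 0\<close>.\<close>
    define v where "v i = (if i = 0 then a else if i = Suc 0 then b else 0)" for i :: nat
    have "v sums (\<Sum>i\<in>{0,1}. v i)"
      by (rule sums_finite) (auto simp: v_def)
    then have v: "v sums (a + b)" by (simp add: v_def)
    have pv: "(\<lambda>i. p (v i)) sums (\<Sum>i\<in>{0,1}. p (v i))"
      by (rule sums_finite) (auto simp: v_def p0)
    have "p (a + b) \<le> (\<Sum>i. p (v i))"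
    proof (rule countably_subadditive[OF _ v sums_summable[OF pv]])
      show "v i \<in> S" for i using that 0 by (simp add: v_def)
    qed
    with pv show ?thesis by (simp add: v_def sums_iff)
  qed
  \<comment> \<open>\<open>p\<close> is not assumed continuous, so the sublevel sets may fail to be
    closed; Baire's theorem is applied to their closures, which cover \<open>S\<close>.\<close>
  define E where "E n = {y\<in>S. p y \<le> real n}" for n :: nat
  have ES: "closure (E n) \<subseteq> S" for n
    using S(1) by (intro closure_minimal) (auto simp: E_def)
  let ?X = "top_of_set S"
  have "\<exists>n. ?X interior_of closure (E n) \<noteq> {}"
  proof (rule ccontr)
    assume "\<nexists>n. ?X interior_of closure (E n) \<noteq> {}"
    then have "?X interior_of \<Union>(range (\<lambda>n. closure (E n))) = {}"
      using S(1) ES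
      by (intro Baire_category_alt disjI1 completely_metrizable_space_closedin
            [OF completely_metrizable_space_euclidean])
         (auto intro!: closed_subset)
    moreover have "\<Union>(range (\<lambda>n. closure (E n))) = S"
    proof
      show "S \<subseteq> \<Union>(range (\<lambda>n. closure (E n)))"
      proof
        fix y assume "y \<in> S"
        moreover obtain n where "p y \<le> real n" using real_arch_simple by blast
        ultimately have "y \<in> E n" by (simp add: E_def)
        then show "y \<in> \<Union>(range (\<lambda>n. closure (E n)))"
          using closure_subset by blast
      qed
    qed (use ES in blast)
    ultimately show False using 0 by (simp add: interior_of_topspace[of ?X, simplified])
  qed
  then obtain n a where a: "a \<in> ?X interior_of closure (E n)" by blast
  have "openin ?X (?X interior_of closure (E n))" by simp
  then obtain r where r: "0 < r" and ball: "\<And>y. y \<in> S \<Longrightarrow> dist y a < r \<Longrightarrow> y \<in> closure (E n)"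
    using a interior_of_subset[of ?X "closure (E n)"] unfolding openin_euclidean_subtopology_iff
    by (metis subsetD)
  have aS: "a \<in> S" using a interior_of_subset[of ?X] ES by blast
  \<comment> \<open>The ball is moved from \<open>a\<close> to \<open>0\<close>: both
    \<open>a + y\<close> and \<open>a - y\<close> lie in the closure, and half the difference of
    their approximants is close to \<open>y\<close>. Homogeneity with factors \<open>1/2\<close> and
    \<open>- (1/2)\<close> keeps \<open>p\<close> at most \<open>n\<close>.\<close>
  have approx: "\<exists>v\<in>S. p v \<le> real n \<and> norm (y - v) < \<delta>"
    if y: "y \<in> S" "norm y < r" and "0 < \<delta>" for y \<delta>
  proof -
    have "a + y \<in> closure (E n)" "a - y \<in> closure (E n)"
      using y aS S(2) by (auto intro!: ball simp: subspace_add subspace_diff dist_norm)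
    then obtain u w where u: "u \<in> E n" "norm (u - (a + y)) < \<delta>"
      and w: "w \<in> E n" "norm (w - (a - y)) < \<delta>"
      using \<open>0 < \<delta>\<close> unfolding closure_approachable dist_norm by meson
    define v where "v = (1/2) *\<^sub>R u + (- (1/2)) *\<^sub>R w"
    have uw: "u \<in> S" "w \<in> S" "p u \<le> n" "p w \<le> n" using u w by (auto simp: E_def)
    then have "v \<in> S" using S(2) by (simp add: v_def subspace_add subspace_scale subspace_diff)
    moreover have "p v \<le> p ((1/2) *\<^sub>R u) + p ((- (1/2)) *\<^sub>R w)"
      unfolding v_def using uw S(2) by (intro subadditive subspace_scale)
    with uw homogeneous[of u "1/2"] homogeneous[of w "- (1/2)"] have "p v \<le> n" by simp
    moreover have "y - v = (1/2) *\<^sub>R (w - (a - y)) - (1/2) *\<^sub>R (u - (a + y))"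
      by (simp add: v_def algebra_simps flip: scaleR_add_left)
    then have "norm (y - v) \<le> (1/2) * norm (w - (a - y)) + (1/2) * norm (u - (a + y))"
      by (metis norm_triangle_ineq4 norm_scaleR abs_of_pos half_gt_zero zero_less_one)
    with u w have "norm (y - v) < \<delta>" by simp
    ultimately show ?thesis by blast
  qed
  \<comment> \<open>Rescaling with error \<open>r/2\<close>: a correction of cost
    \<open>t * n\<close> leaves a remainder in a ball of half the radius, so it can be
    iterated.\<close>
  have approx_scaled: "\<exists>v\<in>S. p v \<le> t * real n \<and> norm (y - v) < t / 2 * r"
    if y: "y \<in> S" "norm y < t * r" and t: "0 < t" for y t
  proof -
    have "norm ((1/t) *\<^sub>R y) < r" using y t by (simp add: field_simps)
    moreover have "(1/t) *\<^sub>R y \<in> S" using y S(2) by (simp add: subspace_scale)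
    ultimately obtain v where v: "v \<in> S" "p v \<le> n" "norm ((1/t) *\<^sub>R y - v) < r / 2"
      using approx[of "(1/t) *\<^sub>R y" "r/2"] r by auto
    have "y - t *\<^sub>R v = t *\<^sub>R ((1/t) *\<^sub>R y - v)" using t by (simp add: algebra_simps)
    then have "norm (y - t *\<^sub>R v) = t * norm ((1/t) *\<^sub>R y - v)" using t by simp
    also have "\<dots> < t * (r/2)" using v t by (intro mult_strict_left_mono)
    finally have "norm (y - t *\<^sub>R v) < t / 2 * r" by simp
    moreover have "p (t *\<^sub>R v) \<le> t * n"
      using order_trans[OF homogeneous[OF v(1), of t] mult_left_mono[OF v(2) abs_ge_zero]] t by simp
    moreover have "t *\<^sub>R v \<in> S" using v S(2) by (simp add: subspace_scale)
    ultimately show ?thesis by blast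
  qed
  have unit: "p y \<le> 2 * real n" if y: "y \<in> S" "norm y < r" for y
  proof -
    \<comment> \<open>\<open>z i\<close> is the remainder after \<open>i\<close> corrections. The
      corrections \<open>z i - z (Suc i)\<close> telescope to \<open>y\<close>, and their costs form
      a geometric series with sum \<open>2 * n\<close>.\<close>
    have "\<exists>z. \<forall>i. ((z i \<in> S \<and> norm (z i) < (1/2)^i * r) \<and> (i = 0 \<longrightarrow> z i = y)) \<and>
      p (z i - z (Suc i)) \<le> (1/2)^i * real n"
    proof (rule dependent_nat_choice)
      show "\<exists>z. (z \<in> S \<and> norm z < (1/2)^0 * r) \<and> (0 = (0::nat) \<longrightarrow> z = y)" using y by auto
    next
      fix z :: 'a and i :: nat
      assume z: "(z \<in> S \<and> norm z < (1/2)^i * r) \<and> (i = 0 \<longrightarrow> z = y)"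
      then obtain v where "v \<in> S" "p v \<le> (1/2)^i * real n" "norm (z - v) < (1/2)^i / 2 * r"
        using approx_scaled[of z "(1/2)^i"] by auto
      then show "\<exists>z'. ((z' \<in> S \<and> norm z' < (1/2)^Suc i * r) \<and> (Suc i = 0 \<longrightarrow> z' = y)) \<and>
          p (z - z') \<le> (1/2)^i * real n"
        using z S(2) by (intro exI[of _ "z - v"]) (auto simp: subspace_diff)
    qed
    then obtain z where z: "z 0 = y" "\<And>i. z i \<in> S" "\<And>i. norm (z i) < (1/2)^i * r"
        "\<And>i. p (z i - z (Suc i)) \<le> (1/2)^i * real n" by blast
    have "z \<longlonglongrightarrow> 0"
    proof (rule Lim_null_comparison)
      show "\<forall>\<^sub>F i in sequentially. norm (z i) \<le> (1/2)^i * r"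
        using z(3) by (intro always_eventually allI less_imp_le)
      show "(\<lambda>i. (1/2)^i * r) \<longlonglongrightarrow> 0"
        by (intro tendsto_mult_left_zero LIMSEQ_power_zero) simp
    qed
    from telescope_sums'[OF this] have sums: "(\<lambda>i. z i - z (Suc i)) sums y" by (simp add: z(1))
    have zS: "z i - z (Suc i) \<in> S" for i using z(2) S(2) by (simp add: subspace_diff)
    have geo: "(\<lambda>i. (1/2)^i * real n) sums (2 * real n)"
      using sums_mult2[OF geometric_sums[of "1/2::real"], of "real n"] by simp
    have summ: "summable (\<lambda>i. p (z i - z (Suc i)))"
      using nonneg[OF zS] z(4) by (intro summable_comparison_test'[OF sums_summable[OF geo], of 0]) simp
    have "p y \<le> (\<Sum>i. p (z i - z (Suc i)))"
      using zS sums summ by (rule countably_subadditive)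
    also have "\<dots> \<le> (\<Sum>i. (1/2)^i * real n)"
      using z(4) summ sums_summable[OF geo] by (rule suminf_le)
    also have "\<dots> = 2 * real n" using geo by (simp add: sums_iff)
    finally show ?thesis .
  qed
  have "p y \<le> (4 * real n / r) * norm y" if y: "y \<in> S" for y
  proof (cases "y = 0")
    case True
    then show ?thesis by (simp add: p0)
  next
    case False
    \<comment> \<open>This puts \<open>c *\<^sub>R y\<close> at norm \<open>r / 2\<close>, strictly
      inside the ball where \<open>unit\<close> applies.\<close>
    define c where "c = r / (2 * norm y)"
    have c: "0 < c" using False r by (simp add: c_def)
    have "norm (c *\<^sub>R y) < r" using False r by (simp add: c_def)
    then have "p (c *\<^sub>R y) \<le> 2 * real n" using y S(2) by (intro unit subspace_scale)
    moreover have "p y \<le> (1/c) * p (c *\<^sub>R y)"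
      using homogeneous[of "c *\<^sub>R y" "1/c"] c y S(2) by (simp add: subspace_scale)
    ultimately have "p y \<le> (1/c) * (2 * real n)"
      using c by (meson mult_left_mono order_trans less_imp_le zero_less_divide_1_iff)
    then show ?thesis using False r by (simp add: c_def field_simps)
  qed
  then show ?thesis by blast
qed

section \<open>Equivalence of the criteria\<close>

text \<open>A vanishing member would give \<open>0\<close> two expansions. This permits division by
  \<open>norm (x k)\<close> when coefficients are bounded by partial sums.\<close>

lemma schauder_basic_nonzero:
  assumes "schauder_basic x"
  shows "x k \<noteq> 0"
proof
  assume "x k = 0"
  then have "partial_sum (\<lambda>i. if i = k then 1 else 0) x = (\<lambda>_. 0)"
    by (intro ext) (auto simp: partial_sum_def intro!: sum.neutral)
  moreover have "partial_sum (\<lambda>_. 0) x = (\<lambda>_. 0)"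
    by (intro ext) (simp add: partial_sum_def)
  moreover have "0 \<in> closure (span (range x))"
    using closure_subset span_0 by blast
  ultimately have "(\<lambda>i. if i = k then 1 else 0) = (\<lambda>_. 0::real)"
    using assms unfolding schauder_basic_def by (metis tendsto_const)
  then show False by (metis zero_neq_one)
qed

text \<open>The norm bound on the functional \<open>p\<close> is evaluated at finite sums. The
  carriers \<open>A\<close> and \<open>B\<close> are independent, as neither criterion refers to its
  carrier.\<close>

lemma maximal_bounded_imp_maximal_inequality:
  fixes x :: "nat \<Rightarrow> 'a::banach_lattice"
  assumes basic: "schauder_basic x"
    and "satisfies_criterion Maximal_Norm_Boundedness A x"
  shows "satisfies_criterion Maximal_Inequality B x"
proof -
  define S where "S = closure (span (range x))"
  have S: "closed S" "subspace S" by (simp_all add: S_def subspace_closure)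
  define coeff where "coeff y = (THE \<alpha>. partial_sum \<alpha> x \<longlonglongrightarrow> y)" for y
  have unique: "\<exists>!\<alpha>. partial_sum \<alpha> x \<longlonglongrightarrow> y" if "y \<in> S" for y
    using basic that by (simp add: schauder_basic_def S_def)
  have coeff: "partial_sum (coeff y) x \<longlonglongrightarrow> y" if "y \<in> S" for y
    using theI'[OF unique[OF that]] by (simp add: coeff_def)
  have coeff_eq: "coeff y = \<alpha>" if "partial_sum \<alpha> x \<longlonglongrightarrow> y" "y \<in> S" for \<alpha> y
    using the1_equality[OF unique[OF that(2)], OF that(1)] by (simp add: coeff_def)
  define q where "q y m = norm (maximal_partial_sum (coeff y) x m)" for y m
  define p where "p y = (SUP m. q y m)" for y
  \<comment> \<open>The boundedness criterion enters here: it makes the supremum defining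
    \<open>p\<close> a finite one.\<close>
  have bdd: "bdd_above (range (q y))" if "y \<in> S" for y
  proof -
    have "bounded (range (maximal_partial_sum (coeff y) x))"
      using assms(2) coeff[OF that] by auto
    then show ?thesis by (auto simp: q_def bounded_iff bdd_above_def)
  qed
  have q_le_p: "q y m \<le> p y" if "y \<in> S" for y m
    unfolding p_def using bdd[OF that] by (intro cSUP_upper) auto
  have p_le: "p y \<le> b" if "\<And>m. q y m \<le> b" for y b
    unfolding p_def using that by (intro cSUP_least) auto
  have "\<exists>M. \<forall>y\<in>S. p y \<le> M * norm y"
  proof (rule countably_subadditive_imp_bounded[OF S])
    fix y assume y: "y \<in> S"
    show "0 \<le> p y" using q_le_p[OF y, of 0] by (simp add: q_def order_trans[OF norm_ge_zero])
    fix c :: real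
    have "coeff (c *\<^sub>R y) = (\<lambda>k. c * coeff y k)"
      using coeff[OF y] y S(2)
      by (intro coeff_eq) (auto simp: partial_sum_scale[abs_def] subspace_scale intro!: tendsto_scaleR)
    then have "q (c *\<^sub>R y) m \<le> norm (\<bar>c\<bar> *\<^sub>R maximal_partial_sum (coeff y) x m)" for m
      unfolding q_def
    proof (simp only:, intro norm_maximal_partial_sum_le)
      fix n assume "n \<le> m"
      have "\<bar>c *\<^sub>R partial_sum (coeff y) x n\<bar> \<le> \<bar>c\<bar> *\<^sub>R \<bar>partial_sum (coeff y) x n\<bar>"
        by (rule abs_scaleR_le)
      also have "\<dots> \<le> \<bar>c\<bar> *\<^sub>R maximal_partial_sum (coeff y) x m"
        using \<open>n \<le> m\<close> by (intro scaleR_left_mono partial_sum_le_maximal) simp_all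
      finally show "\<bar>partial_sum (\<lambda>k. c * coeff y k) x n\<bar>
          \<le> \<bar>c\<bar> *\<^sub>R maximal_partial_sum (coeff y) x m"
        by (simp only: partial_sum_scale)
    qed
    then have "q (c *\<^sub>R y) m \<le> \<bar>c\<bar> * q y m" for m by (simp add: q_def)
    then show "p (c *\<^sub>R y) \<le> \<bar>c\<bar> * p y"
      using q_le_p[OF y] by (intro p_le) (meson abs_ge_zero mult_left_mono order_trans)
  next
    fix v :: "nat \<Rightarrow> 'a" and y
    assume v: "\<And>i. v i \<in> S" and y: "v sums y" and summ: "summable (\<lambda>i. p (v i))"
    have yS: "y \<in> S" using S v y by (rule closed_subspace_sums)
    let ?P = "\<lambda>i. partial_sum (coeff (v i)) x"
    have P_le: "norm (?P i n) \<le> p (v i)" for i n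
      using norm_partial_sum_le_maximal[of n n] q_le_p[OF v] unfolding q_def by (rule order_trans) simp
    \<comment> \<open>The candidate expansion of \<open>y\<close> adds the expansions of the
      \<open>v i\<close> coefficientwise; uniqueness of coefficients later confirms it.\<close>
    define \<beta> where "\<beta> k = (\<Sum>i. coeff (v i) k)" for k
    \<comment> \<open>The factor 2 comes from writing a term as a difference of consecutive partial
      sums; the first term is itself a partial sum.\<close>
    have term_le: "norm (coeff (v i) k *\<^sub>R x k) \<le> 2 * p (v i)" for i k
    proof (cases k)
      case 0
      then show ?thesis
        using P_le[of i 0] order_trans[OF norm_ge_zero P_le[of i 0]] by (simp add: partial_sum_def)
    next
      case (Suc j)
      then have "coeff (v i) k *\<^sub>R x k = ?P i k - ?P i j" by (simp add: partial_sum_def)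
      then show ?thesis using norm_triangle_ineq4[of "?P i k" "?P i j"] P_le[of i k] P_le[of i j] by simp
    qed
    have "summable (\<lambda>i. coeff (v i) k)" for k
    proof (rule summable_comparison_test')
      show "summable (\<lambda>i. 2 * p (v i) / norm (x k))" using summ by (intro summable_divide summable_mult)
      show "norm (coeff (v i) k) \<le> 2 * p (v i) / norm (x k)" for i
        using term_le[of i k] schauder_basic_nonzero[OF basic, of k] by (simp add: field_simps)
    qed
    then have \<beta>: "(\<lambda>i. ?P i n) sums partial_sum \<beta> x n" for n
      unfolding partial_sum_def \<beta>_def
      by (intro sums_sum bounded_linear.sums[OF bounded_linear_scaleR_left] summable_sums)
    have "partial_sum \<beta> x \<longlonglongrightarrow> y"
    \<comment> \<open>The bounds \<open>p (v i)\<close> do not depend on \<open>n\<close>, so the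
      M-test gives convergence uniform in \<open>n\<close>, and the limits in \<open>n\<close> and
      in the number of summands may be exchanged.\<close>
    proof (rule swap_uniform_limit')
      show "\<forall>\<^sub>F N in sequentially. (\<lambda>n. \<Sum>i<N. ?P i n) \<longlonglongrightarrow> (\<Sum>i<N. v i)"
        by (intro always_eventually allI tendsto_sum coeff v)
      show "(\<lambda>N. \<Sum>i<N. v i) \<longlonglongrightarrow> y" using y by (simp add: sums_def)
      have "uniform_limit UNIV (\<lambda>N n. \<Sum>i<N. ?P i n) (\<lambda>n. \<Sum>i. ?P i n) sequentially"
        using P_le summ by (intro Weierstrass_m_test) auto
      then show "uniform_limit UNIV (\<lambda>N n. \<Sum>i<N. ?P i n) (partial_sum \<beta> x) sequentially"
        by (simp flip: sums_unique[OF \<beta>])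
    qed simp_all
    then have coeff_y: "coeff y = \<beta>" using yS by (rule coeff_eq)
    show "p y \<le> (\<Sum>i. p (v i))"
    proof (rule p_le)
      fix m
      let ?w = "\<lambda>i. maximal_partial_sum (coeff (v i)) x m"
      have w_le: "norm (?w i) \<le> p (v i)" for i using q_le_p[OF v] by (simp add: q_def)
      have nsumm: "summable (\<lambda>i. norm (?w i))"
        using w_le by (intro summable_comparison_test'[OF summ, of 0]) simp
      then have w_sums: "?w sums (\<Sum>i. ?w i)"
        by (rule summable_norm_cancel[THEN summable_sums])
      \<comment> \<open>The comparison is made in the order first: one element dominates all partial
        sums up to \<open>m\<close>, hence their supremum, and only then are norms taken.\<close>
      have "\<bar>partial_sum \<beta> x n\<bar> \<le> (\<Sum>i. ?w i)" if "n \<le> m" for n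
        using \<beta> w_sums partial_sum_le_maximal[OF that] by (rule abs_sums_le)
      then have "q y m \<le> norm (\<Sum>i. ?w i)"
        unfolding q_def coeff_y by (rule norm_maximal_partial_sum_le)
      also have "\<dots> \<le> (\<Sum>i. norm (?w i))" using nsumm by (rule summable_norm)
      also have "\<dots> \<le> (\<Sum>i. p (v i))" using w_le nsumm summ by (rule suminf_le)
      finally show "q y m \<le> (\<Sum>i. p (v i))" .
    qed
  qed
  then obtain M where M: "\<And>y. y \<in> S \<Longrightarrow> p y \<le> M * norm y" by blast
  \<comment> \<open>The criterion asks for a constant of at least 1, whence
    \<open>max M 1\<close>.\<close>
  have "norm (maximal_partial_sum \<alpha> x m) \<le> max M 1 * norm (partial_sum \<alpha> x m)" for \<alpha> m
  proof -
    let ?\<alpha> = "\<lambda>k. if k \<le> m then \<alpha> k else 0" and ?y = "partial_sum \<alpha> x m"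
    have "?y \<in> span (range x)"
      by (rule partial_sum_mem) (simp_all add: span_base)
    then have y: "?y \<in> S" unfolding S_def using closure_subset by blast
    have "partial_sum ?\<alpha> x \<longlonglongrightarrow> ?y"
      by (rule tendsto_eventually)
        (auto simp: partial_sum_truncate min_def eventually_sequentially intro!: exI[of _ m])
    then have "coeff ?y = ?\<alpha>" using y by (rule coeff_eq)
    moreover have "norm (maximal_partial_sum \<alpha> x m) \<le> norm (maximal_partial_sum ?\<alpha> x m)"
    proof (rule norm_maximal_partial_sum_le)
      fix n assume "n \<le> m"
      then have "partial_sum \<alpha> x n = partial_sum ?\<alpha> x n" by (simp add: partial_sum_truncate)
      with \<open>n \<le> m\<close> show "\<bar>partial_sum \<alpha> x n\<bar> \<le> maximal_partial_sum ?\<alpha> x m"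
        using partial_sum_le_maximal by metis
    qed
    ultimately have "norm (maximal_partial_sum \<alpha> x m) \<le> p ?y"
      using q_le_p[OF y, of m] by (simp add: q_def)
    also have "\<dots> \<le> M * norm ?y" using M y by blast
    also have "\<dots> \<le> max M 1 * norm ?y" by (intro mult_right_mono) simp_all
    finally show ?thesis .
  qed
  then show ?thesis by (auto intro!: exI[of _ "max M 1"])
qed

text \<open>Blocks of the series whose sums decay like \<open>4\<^sup>-\<^sup>j\<close> have maximal partial sums \<open>v j\<close> of the same
  size, so the weighted sum \<open>e\<close> of the \<open>2\<^sup>j v j\<close> exists and regulates the convergence.\<close>

lemma maximal_inequality_imp_uniform:
  assumes A: "closed_sublattice A" and xA: "\<And>k. x k \<in> A"
    and "satisfies_criterion Maximal_Inequality A x"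
  shows "satisfies_criterion Uniform_Convergence A x"
proof -
  from assms(3) obtain M where M: "1 \<le> M"
    "\<And>m \<alpha>. norm (maximal_partial_sum \<alpha> x m) \<le> M * norm (partial_sum \<alpha> x m)" by auto
  have clA: "closed A" "subspace A" using A by (simp_all add: closed_sublattice_def)
  have "uniformly_convergent_in A (partial_sum \<alpha> x) y" if y: "partial_sum \<alpha> x \<longlonglongrightarrow> y" for \<alpha> y
  proof -
    let ?P = "partial_sum \<alpha> x"
    have "Cauchy ?P" using y by (intro LIMSEQ_imp_Cauchy)
    then have "\<exists>N. \<forall>m\<ge>N. \<forall>n\<ge>N. norm (?P m - ?P n) < (1/4)^j" for j
      by (intro CauchyD) simp_all
    then obtain N where N: "\<And>j m n. m \<ge> N j \<Longrightarrow> n \<ge> N j \<Longrightarrow> norm (?P m - ?P n) < (1/4)^j"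
      by metis
    \<comment> \<open>The sum majorizes \<open>N j\<close>, and the added \<open>j\<close> makes the
      block ends strictly increasing and unbounded.\<close>
    define b where "b j = (\<Sum>i\<le>j. N i) + j" for j
    have bN: "N j \<le> b j" for j
      unfolding b_def by (simp add: trans_le_add1 member_le_sum)
    have b_less: "b j < b (Suc j)" for j by (simp add: b_def)
    then have b_mono: "i \<le> j \<Longrightarrow> b i \<le> b j" for i j
      by (metis lift_Suc_mono_le less_imp_le)
    have b_ge: "j \<le> b j" for j by (simp add: b_def)
    \<comment> \<open>Zeroing the coefficients up to \<open>b j\<close> makes this the maximal
      oscillation of the partial sums from \<open>b j\<close> to \<open>b (Suc j)\<close>.\<close>
    define v where "v j = maximal_partial_sum (\<lambda>k. if k \<le> b j then 0 else \<alpha> k) x (b (Suc j))" for j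
    have v_ge: "\<bar>?P n - ?P (b j)\<bar> \<le> v j" if "b j \<le> n" "n \<le> b (Suc j)" for n j
      using partial_sum_le_maximal[OF that(2), of "\<lambda>k. if k \<le> b j then 0 else \<alpha> k" x] that(1)
      by (simp add: v_def partial_sum_block max_def)
    have v_nonneg: "0 \<le> v j" for j by (simp add: v_def maximal_partial_sum_nonneg)
    have v_norm: "norm (v j) \<le> M * (1/4)^j" for j
    proof -
      have "norm (v j) \<le> M * norm (?P (b (Suc j)) - ?P (b j))"
        using M(2)[of "\<lambda>k. if k \<le> b j then 0 else \<alpha> k" "b (Suc j)"] b_less[of j]
        by (simp add: v_def partial_sum_block max_def)
      also have "\<dots> \<le> M * (1/4)^j"
        using M(1) N[of j "b (Suc j)" "b j"] bN[of j] b_less[of j] by (intro mult_left_mono) simp_all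
      finally show ?thesis .
    qed
    \<comment> \<open>The weight \<open>2^j\<close> provides the factor \<open>(1/2)^J\<close> for
      all \<open>j \<ge> J\<close>, and the extra 2 pays for two uses of \<open>v j\<close> per
      telescoping step. The norms still decay like \<open>(1/2)^j\<close>.\<close>
    define w where "w j = (2 * 2^j) *\<^sub>R v j" for j
    have wA: "w j \<in> A" for j
      unfolding w_def v_def using clA(2) maximal_partial_sum_mem[OF A xA] by (simp add: subspace_scale)
    have w_nonneg: "0 \<le> w j" for j by (simp add: w_def v_nonneg scaleR_nonneg_nonneg)
    have "summable w"
    proof (rule summable_comparison_test')
      show "summable (\<lambda>j. (2 * M) * (1/2)^j)" by (intro summable_mult summable_geometric) simp
      show "norm (w j) \<le> (2 * M) * (1/2)^j" for j
      proof -
        have "norm (w j) = (2 * 2^j) * norm (v j)" by (simp add: w_def)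
        also have "\<dots> \<le> (2 * 2^j) * (M * (1/4)^j)" by (intro mult_left_mono v_norm) simp
        also have "\<dots> = (2 * M) * (2 * (1/4))^j" unfolding power_mult_distrib by (simp add: mult_ac)
        finally show ?thesis by simp
      qed
    qed
    then obtain e where e: "w sums e" by (auto simp: summable_def)
    have eA: "e \<in> A" using clA wA e by (rule closed_subspace_sums)
    have "\<bar>0\<bar> \<le> e" by (rule abs_sums_le[OF sums_zero e]) (simp add: w_nonneg)
    then have e0: "0 \<le> e" by simp
    have rate: "\<bar>?P n - y\<bar> \<le> (1/2)^J *\<^sub>R e" if n: "b J \<le> n" for n J
    proof -
      \<comment> \<open>The telescope runs through block ends but starts at \<open>n\<close>, as
        \<open>b 0 \<le> b J \<le> n\<close>. Steps ending at or before \<open>n\<close> vanish, and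
        every other step has \<open>i \<ge> J\<close>.\<close>
      let ?f = "\<lambda>i. ?P (max n (b i))"
      have "?f \<longlonglongrightarrow> y"
      proof (rule filterlim_compose[OF y])
        show "filterlim (\<lambda>i. max n (b i)) at_top sequentially"
          using b_ge by (intro filterlim_at_top_mono[OF filterlim_ident] always_eventually)
            (simp add: le_max_iff_disj)
      qed
      moreover have "max n (b 0) = n" using b_mono[of 0 J] n by simp
      ultimately have "(\<lambda>i. ?f i - ?f (Suc i)) sums (?P n - y)"
        using telescope_sums'[of ?f y] by simp
      moreover have "(\<lambda>i. (1/2)^J *\<^sub>R w i) sums ((1/2)^J *\<^sub>R e)"
        using e by (rule sums_scaleR_right)
      moreover have "\<bar>?f i - ?f (Suc i)\<bar> \<le> (1/2)^J *\<^sub>R w i" for i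
      proof (cases "n \<ge> b (Suc i)")
        case True
        then have "max n (b i) = n" "max n (b (Suc i)) = n" using b_less[of i] by simp_all
        then show ?thesis by (simp add: w_nonneg scaleR_nonneg_nonneg)
      next
        case False
        then have "J \<le> i" using n b_mono[of "Suc i" J] by (meson not_less_eq_eq order_trans)
        \<comment> \<open>Both positions lie in the block starting at \<open>b i\<close>, so each
          partial sum differs from the one at \<open>b i\<close> by at most
          \<open>v i\<close>.\<close>
        have "\<bar>?f i - ?f (Suc i)\<bar> \<le> \<bar>?f i - ?P (b i)\<bar> + \<bar>?f (Suc i) - ?P (b i)\<bar>"
          using abs_triangle_ineq4[of "?f i - ?P (b i)" "?f (Suc i) - ?P (b i)"] by simp
        also have "\<dots> \<le> v i + v i"
          using False b_less[of i] by (intro add_mono v_ge) (auto simp: max_def)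
        also have "\<dots> = 2 *\<^sub>R v i" by (simp add: scaleR_2)
        also have "\<dots> \<le> (2 * ((1/2)^J * 2^i)) *\<^sub>R v i"
        proof (intro scaleR_right_mono v_nonneg)
          have "(2::real)^J \<le> 2^i" using \<open>J \<le> i\<close> by (intro power_increasing) simp_all
          then show "(2::real) \<le> 2 * ((1/2)^J * 2^i)" by (simp add: power_one_over field_simps)
        qed
        also have "\<dots> = (1/2)^J *\<^sub>R w i" by (simp add: w_def mult_ac)
        finally show ?thesis .
      qed
      ultimately show ?thesis by (rule abs_sums_le)
    qed
    show ?thesis unfolding uniformly_convergent_in_def
    proof (intro bexI[OF _ eA] conjI e0 allI impI)
      fix \<epsilon> :: real assume "0 < \<epsilon>"
      then obtain J where J: "(1/2)^J < \<epsilon>" using real_arch_pow_inv[of \<epsilon> "1/2"] by auto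
      have "\<bar>?P n - y\<bar> \<le> \<epsilon> *\<^sub>R e" if "b J \<le> n" for n
        using rate[OF that] by (rule order_trans) (intro scaleR_right_mono e0 less_imp_le J)
      then show "\<forall>\<^sub>F n in sequentially. \<bar>?P n - y\<bar> \<le> \<epsilon> *\<^sub>R e"
        by (auto simp: eventually_sequentially)
    qed
  qed
  then show ?thesis by simp
qed

section \<open>From uniform convergence through order convergence to order bounds\<close>

text \<open>The finitely many exceptional deviations are added to \<open>e\<close>; their sum stays
  in \<open>A\<close>. Keeping \<open>e \<le> e'\<close> lets the new bound replace \<open>e\<close>
  as a regulator.\<close>

lemma eventually_dominated_imp_dominated:
  fixes z :: "nat \<Rightarrow> 'a::banach_lattice"
  assumes A: "closed_sublattice A" and zA: "\<And>n. z n \<in> A" "l \<in> A" and e: "e \<in> A" "0 \<le> e"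
    and ev: "\<forall>\<^sub>F n in sequentially. \<bar>z n - l\<bar> \<le> e"
  shows "\<exists>e'\<in>A. e \<le> e' \<and> (\<forall>n. \<bar>z n - l\<bar> \<le> e')"
proof -
  have subA: "subspace A" using A by (simp add: closed_sublattice_def)
  from ev obtain N where N: "\<And>n. n \<ge> N \<Longrightarrow> \<bar>z n - l\<bar> \<le> e"
    by (auto simp: eventually_sequentially)
  define s where "s = (\<Sum>n<N. \<bar>z n - l\<bar>)"
  have s: "0 \<le> s" by (simp add: s_def sum_nonneg)
  have "s \<in> A" unfolding s_def
    using subA zA by (intro subspace_sum closed_sublattice_abs[OF A] subspace_diff)
  with subA e have "e + s \<in> A" by (simp add: subspace_add)
  moreover have "e \<le> e + s" using s by simp
  moreover have "\<bar>z n - l\<bar> \<le> e + s" for n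
  proof (cases "n < N")
    case True
    then have "\<bar>z n - l\<bar> \<le> s" unfolding s_def
      using sum_mono2[of "{..<N}" "{n}" "\<lambda>n. \<bar>z n - l\<bar>"] by simp
    then show ?thesis using e(2) by (simp add: add_increasing)
  next
    case False
    then show ?thesis using N[of n] s by (simp add: add_increasing2)
  qed
  ultimately show ?thesis by blast
qed

text \<open>The dominating sequence consists of multiples of one regulator, with scalars decreasing
  to zero: nearly the best admissible scalar for each tail.\<close>

lemma uniformly_convergent_imp_sigma_order:
  fixes z :: "nat \<Rightarrow> 'a::banach_lattice"
  assumes A: "closed_sublattice A" and zA: "\<And>n. z n \<in> A" "l \<in> A"
    and "uniformly_convergent_in A z l"
  shows "sigma_order_convergent_in A z l"
proof -
  have subA: "subspace A" using A by (simp add: closed_sublattice_def)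
  from assms(4) obtain e0 where e0: "e0 \<in> A" "0 \<le> e0"
    and conv0: "\<And>\<epsilon>. 0 < \<epsilon> \<Longrightarrow> \<forall>\<^sub>F n in sequentially. \<bar>z n - l\<bar> \<le> \<epsilon> *\<^sub>R e0"
    by (auto simp: uniformly_convergent_in_def)
  have "\<forall>\<^sub>F n in sequentially. \<bar>z n - l\<bar> \<le> e0" using conv0[of 1] by simp
  from eventually_dominated_imp_dominated[OF A zA e0 this]
  obtain e where e: "e \<in> A" "e0 \<le> e" and dom: "\<And>n. \<bar>z n - l\<bar> \<le> e" by blast
  have e_nonneg: "0 \<le> e" using e0(2) e(2) by (rule order_trans)
  have conv: "\<forall>\<^sub>F n in sequentially. \<bar>z n - l\<bar> \<le> \<epsilon> *\<^sub>R e" if "0 < \<epsilon>" for \<epsilon>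
    using conv0[OF that]
  proof eventually_elim
    case (elim n)
    also have "\<epsilon> *\<^sub>R e0 \<le> \<epsilon> *\<^sub>R e" using that e(2) by (intro scaleR_left_mono) simp_all
    finally show ?case .
  qed
  define C where "C n = {c. 0 \<le> c \<and> (\<forall>k\<ge>n. \<bar>z k - l\<bar> \<le> c *\<^sub>R e)}" for n :: nat
  \<comment> \<open>Enlarging the regulator to dominate every deviation was done for this: each set
    of admissible scalars is nonempty.\<close>
  have C1: "1 \<in> C n" for n using dom by (simp add: C_def)
  have C_bdd: "bdd_below (C n)" for n by (auto simp: C_def bdd_below_def)
  \<comment> \<open>The positive summand lies strictly above the infimum, so an admissible scalar
    below \<open>c n\<close> exists whether or not the infimum is attained; it also decreases to
    zero.\<close>
  define c where "c n = Inf (C n) + inverse (real (Suc n))" for n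
  have c_bound: "\<bar>z n - l\<bar> \<le> c n *\<^sub>R e" for n
  proof -
    have "Inf (C n) < c n" by (simp add: c_def)
    then obtain d where "d \<in> C n" "d < c n"
      using C1 C_bdd cInf_less_iff[of "C n"] by blast
    then have "\<bar>z n - l\<bar> \<le> d *\<^sub>R e" by (simp add: C_def)
    also have "\<dots> \<le> c n *\<^sub>R e" using \<open>d < c n\<close> e_nonneg by (intro scaleR_right_mono) simp_all
    finally show ?thesis .
  qed
  have Inf_nonneg: "0 \<le> Inf (C n)" for n
    using C1[of n] by (intro cInf_greatest) (blast, simp add: C_def)
  have c_dec: "c n \<le> c m" if "m \<le> n" for m n
  proof -
    have "C m \<subseteq> C n" using that by (auto simp: C_def)
    then have "Inf (C n) \<le> Inf (C m)" using C1[of m] C_bdd by (intro cInf_superset_mono) auto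
    moreover have "inverse (real (Suc n)) \<le> inverse (real (Suc m))"
      using that by (intro le_imp_inverse_le) simp_all
    ultimately show ?thesis unfolding c_def by (rule add_mono)
  qed
  have "(\<lambda>n. Inf (C n)) \<longlonglongrightarrow> 0"
  proof (rule order_tendstoI)
    fix a :: real assume "a < 0"
    then show "\<forall>\<^sub>F n in sequentially. a < Inf (C n)"
      by (intro always_eventually allI less_le_trans[OF _ Inf_nonneg])
  next
    fix a :: real assume "0 < a"
    then obtain N where N: "\<And>n. n \<ge> N \<Longrightarrow> \<bar>z n - l\<bar> \<le> (a/2) *\<^sub>R e"
      using conv[of "a/2"] by (auto simp: eventually_sequentially)
    have "Inf (C n) < a" if "n \<ge> N" for n
    proof -
      have "a/2 \<in> C n" using N that \<open>0 < a\<close> by (simp add: C_def)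
      then have "Inf (C n) \<le> a/2" using C_bdd by (rule cInf_lower)
      with \<open>0 < a\<close> show ?thesis by simp
    qed
    then show "\<forall>\<^sub>F n in sequentially. Inf (C n) < a" by (auto simp: eventually_sequentially)
  qed
  then have "c \<longlonglongrightarrow> 0 + 0" unfolding c_def by (intro tendsto_add LIMSEQ_inverse_real_of_nat)
  then have c_lim: "(\<lambda>n. c n *\<^sub>R e) \<longlonglongrightarrow> 0" 
    using tendsto_scaleR[OF _ tendsto_const, of c "0 + 0"] by simp
  have c_nonneg: "0 \<le> c n" for n using Inf_nonneg[of n] by (simp add: c_def)
  let ?u = "\<lambda>n. c n *\<^sub>R e"
  have "isGlb A (range ?u) 0"
  proof (rule isGlbI2)
    show "isLb A (range ?u) 0"
      using subA c_nonneg e_nonneg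
      by (auto simp: isLb_def setge_def subspace_0 scaleR_nonneg_nonneg)
    \<comment> \<open>Norm convergence to zero together with the closed order forces every lower
      bound below zero.\<close>
    have "h \<le> 0" if "isLb A (range ?u) h" for h
      using that
      by (intro tendsto_le_lattice[OF sequentially_bot tendsto_const c_lim])
        (auto simp: isLb_def setge_def)
    then show "Collect (isLb A (range ?u)) *<= 0" by (simp add: setle_def)
  qed
  moreover have "range ?u \<subseteq> A" using subA e(1) by (auto simp: subspace_scale)
  moreover have "decseq ?u" using c_dec e_nonneg by (auto simp: decseq_def intro: scaleR_right_mono)
  ultimately show ?thesis
    unfolding sigma_order_convergent_in_def using c_bound by (intro exI[of _ ?u]) blast
qed

text \<open>A decreasing sequence is a net indexed by the naturals;
  \<open>order_convergent_inI\<close> reindexes it by its range, as the definition takes index sets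
  inside the space.\<close>

lemma sigma_order_convergent_imp_order:
  assumes "sigma_order_convergent_in A z l"
  shows "order_convergent_in A z l"
proof -
  from assms obtain u where u: "range u \<subseteq> A" "decseq u" "isGlb A (range u) 0"
    "\<And>n. \<bar>z n - l\<bar> \<le> u n" by (auto simp: sigma_order_convergent_in_def)
  have "directed_preorder (UNIV :: nat set) (\<le>)"
    by (auto simp: directed_preorder_def intro: max.cobounded1 max.cobounded2)
  then have "net_decreases_to_zero_in A (UNIV :: nat set) (\<le>) u"
    using u by (auto simp: net_decreases_to_zero_in_def decseq_def)
  moreover have "\<forall>i\<in>UNIV. \<forall>\<^sub>F n in sequentially. \<bar>z n - l\<bar> \<le> u i"
    unfolding eventually_sequentially using u(4) decseqD[OF u(2)] order_trans by blast
  ultimately show ?thesis by (rule order_convergent_inI)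
qed

text \<open>A single member of the dominating net bounds a tail of the deviations, and the finitely
  many remaining terms are absorbed.\<close>

lemma order_convergent_imp_order_bounded:
  fixes z :: "nat \<Rightarrow> 'a::banach_lattice"
  assumes A: "closed_sublattice A" and zA: "\<And>n. z n \<in> A" "l \<in> A"
    and "order_convergent_in A z l"
  shows "order_bounded_in A z"
proof -
  have subA: "subspace A" using A by (simp add: closed_sublattice_def)
  from assms(4) obtain I :: "'a set" and r u where net: "net_decreases_to_zero_in A I r u"
    and dom: "\<forall>i\<in>I. \<forall>\<^sub>F n in sequentially. \<bar>z n - l\<bar> \<le> u i"
    by (auto simp: order_convergent_in_def)
  have "I \<noteq> {}" and uA: "u ` I \<subseteq> A" and glb: "isGlb A (u ` I) 0"
    using net by (simp_all add: net_decreases_to_zero_in_def directed_preorder_def)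
  then obtain i where "i \<in> I" by blast
  then have i: "i \<in> I" "u i \<in> A" "0 \<le> u i"
    using uA isGlbD2[OF glb] by auto
  with dom have "\<forall>\<^sub>F n in sequentially. \<bar>z n - l\<bar> \<le> u i" by blast
  from eventually_dominated_imp_dominated[OF A zA i(2,3) this]
  obtain e where e: "e \<in> A" "\<And>n. \<bar>z n - l\<bar> \<le> e" by blast
  have "l - e \<le> z n \<and> z n \<le> l + e" for n
    using e(2)[of n] abs_ge_self[of "z n - l"] abs_ge_minus_self[of "z n - l"]
    by (metis order_trans diff_le_eq le_diff_eq minus_diff_eq add.commute)
  moreover have "l - e \<in> A" "l + e \<in> A" using subA zA e by (simp_all add: subspace_add subspace_diff)
  ultimately show ?thesis unfolding order_bounded_in_def by blast
qed

text \<open>Order bounds \<open>a\<close> and \<open>b\<close> put every absolute value below the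
  sum of theirs, an element independent of \<open>m\<close>.\<close>

lemma order_bounded_imp_maximal_bounded:
  assumes "order_bounded_in A (partial_sum \<alpha> x)"
  shows "bounded (range (maximal_partial_sum \<alpha> x))"
proof -
  from assms obtain a b where ab: "\<And>n. a \<le> partial_sum \<alpha> x n" "\<And>n. partial_sum \<alpha> x n \<le> b"
    by (auto simp: order_bounded_in_def)
  have "\<bar>partial_sum \<alpha> x n\<bar> \<le> \<bar>a\<bar> + \<bar>b\<bar>" for n
  proof (rule abs_leI)
    show "partial_sum \<alpha> x n \<le> \<bar>a\<bar> + \<bar>b\<bar>"
      using ab(2)[of n] abs_ge_self[of b] by (intro add_increasing) (auto intro: order_trans)
    have "- partial_sum \<alpha> x n \<le> \<bar>a\<bar>"
      using ab(1)[of n] abs_ge_minus_self[of a] by (metis neg_le_iff_le order_trans)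
    then show "- partial_sum \<alpha> x n \<le> \<bar>a\<bar> + \<bar>b\<bar>" by (intro add_increasing2) auto
  qed
  then have "norm (maximal_partial_sum \<alpha> x m) \<le> norm (\<bar>a\<bar> + \<bar>b\<bar>)" for m
    by (intro norm_maximal_partial_sum_le)
  then show ?thesis by (auto simp: bounded_iff)
qed

section \<open>Closing the cycle and changing the carrier\<close>

text \<open>For a basic sequence the six criteria form a cycle of implications in their listed
  order, closed by the step from the maximal inequality to uniform convergence; otherwise both sides
  are false.\<close>

theorem bibasic_in_iff_maximal_inequality:
  assumes A: "closed_sublattice A" and xA: "\<And>k. x k \<in> A"
  shows "bibasic_in c A x \<longleftrightarrow> bibasic_in Maximal_Inequality A x"
proof (cases "schauder_basic x")
  case True
  have clA: "closed A" "subspace A" using A by (simp_all add: closed_sublattice_def)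
  have PA: "partial_sum \<alpha> x n \<in> A" for \<alpha> n using clA(2) xA by (rule partial_sum_mem)
  have lA: "y \<in> A" if "partial_sum \<alpha> x \<longlonglongrightarrow> y" for \<alpha> y
    using clA(1) PA that by (rule closed_sequentially)
  have 1: "satisfies_criterion Sigma_Order_Convergence A x"
    if "satisfies_criterion Uniform_Convergence A x"
    using that uniformly_convergent_imp_sigma_order[OF A PA lA] by simp
  have 2: "satisfies_criterion Order_Convergence A x"
    if "satisfies_criterion Sigma_Order_Convergence A x"
    using that by (auto intro!: sigma_order_convergent_imp_order)
  have 3: "satisfies_criterion Order_Boundedness A x"
    if "satisfies_criterion Order_Convergence A x"
    using that order_convergent_imp_order_bounded[OF A PA lA] by simp
  have 4: "satisfies_criterion Maximal_Norm_Boundedness A x"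
    if "satisfies_criterion Order_Boundedness A x"
    using that by (auto intro!: order_bounded_imp_maximal_bounded)
  note 5 = maximal_bounded_imp_maximal_inequality[OF True, of A A]
  note 6 = maximal_inequality_imp_uniform[where x = x, OF A xA]
  have "satisfies_criterion c A x \<longleftrightarrow> satisfies_criterion Maximal_Inequality A x"
    using 1 2 3 4 5 6 by (cases c) argo+
  then show ?thesis by (simp add: bibasic_in_def)
qed (simp add: bibasic_in_def)

theorem corollary2p3:
  fixes Y :: "'a::banach_lattice set" and x :: "nat \<Rightarrow> 'a"
  assumes "closed_sublattice Y"
    and "\<And>k. x k \<in> Y"
  shows "\<forall>c. bibasic_in c Y x \<longleftrightarrow> bibasic_in c UNIV x"
proof
  fix c
  have "bibasic_in c Y x \<longleftrightarrow> bibasic_in Maximal_Inequality Y x"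
    using assms by (rule bibasic_in_iff_maximal_inequality)
  \<comment> \<open>The carrier changes here, where unfolding suffices because it does not occur in
    the unfolded statement.\<close>
  also have "\<dots> \<longleftrightarrow> bibasic_in Maximal_Inequality UNIV x"
    by (simp add: bibasic_in_def)
  also have "\<dots> \<longleftrightarrow> bibasic_in c UNIV x"
    by (rule bibasic_in_iff_maximal_inequality[symmetric, OF closed_sublattice_UNIV UNIV_I])
  finally show "bibasic_in c Y x \<longleftrightarrow> bibasic_in c UNIV x" .
qed

end
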